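(* Mitigating reputation bias with the single-attribute mitigation step (defined in the context) for each attribute individually, one after the other in any order, does not necessarily yield reputations without bias for all the attributes. Precisely: there is a $k\ge 2$ such that for every ordering $\pi$ of $\{1,\ldots,k\}$ there exist a finite set of users $\mathcal U$, a finite set of items $\mathcal I$, a set of ratings $\mathcal R=(R_{ui})$, a set of user attributes $\mathcal A=\{A_1,\ldots,A_k\}$, a parameter $\lambda\in\,]0,1[$ and a number of iterations $N\ge1$ such that the following holds. Compute reputations $c_u^N$ with $N$ iterations of the basic reputation-based ranking scheme (defined in the context, with $c_u^0=1$), and then apply the single-attribute mitigation step successively for the attributes $A_{\pi(1)},A_{\pi(2)},\ldots,A_{\pi(k)}$, each application taking as input the reputations output by the previous one (all steps being well defined). Then, for the final reputations $(c_u)_{u\in\mathcal U}$, there are an attribute $A_j\in\mathcal A$ and two classes $a,a'\in A_j$ with $\mathcal U(a),\mathcal U(a')\neq\emptyset$ and $$\frac{1}{|\mathcal U(a)|}\sum_{u\in\mathcal U(a)}c_u\;\neq\;\frac{1}{|\mathcal U(a')|}\sum_{u\in\mathcal U(a')}c_u .$$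
   Context: Ratings: $\mathcal U$ and $\mathcal I$ are finite nonempty sets. $R_{ui}\in\,]0,1]$ if user $u$ rated item $i$, and $R_{ui}=0$ otherwise. $\mathcal U_i=\{u\in\mathcal U: R_{ui}>0\}$ and $\mathcal I_u=\{i\in\mathcal I:R_{ui}>0\}$; these are assumed nonempty for all $i$, $u$. Attributes: each attribute $A_j=\{a_{j,1},\ldots,a_{j,s_j}\}$ is a finite set of classes, and every user $u$ belongs to exactly one class $A_j(u)\in A_j$. For $a\in A_j$, $\mathcal U(a)=\{u\in\mathcal U:A_j(u)=a\}$. Notation: for a finite nonempty family of reals $v_1,\dots,v_n$, $\mathrm{avg}(v)=\frac1n\sum_{i} v_i$ and $\mathrm{std}(v)=\sqrt{\frac1n\sum_{i}(v_i-\mathrm{avg}(v))^2}$. Basic reputation-based ranking scheme: with $\lambda\in\,]0,1[$ and $c_u^0=1$, for $t=0,\ldots,N-1$, $$r_i^{t+1}=\frac{\sum_{u\in\mathcal U_i}R_{ui}c_u^t}{\sum_{u\in\mathcal U_i}c_u^t},\qquad c_u^{t+1}=1-\frac{\lambda}{|\mathcal I_u|}\sum_{i\in\mathcal I_u}|R_{ui}-r_i^{t+1}| .$$ Single-attribute mitigation step for an attribute $A_j$: given input reputations $(\hat c_u)_{u\in\mathcal U}$, let $\mu=\mathrm{avg}(\{\hat c_u\}_{u\in\mathcal U})$, $\sigma=\mathrm{std}(\{\hat c_u\}_{u\in\mathcal U})$, and for each class $a\in A_j$ with $\mathcal U(a)\neq\emptyset$ let $\mu_a=\mathrm{avg}(\{\hat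 c_u\}_{u\in\mathcal U(a)})$, $\sigma_a=\mathrm{std}(\{\hat c_u\}_{u\in\mathcal U(a)})$. The step is well defined if all these $\sigma_a$ are $>0$, and it outputs $$c_u=\mu+(\hat c_u-\mu_a)\frac{\sigma}{\sigma_a}\quad\text{for } u\in\mathcal U(a),\ a\in A_j .$$ Reputations are without bias for an attribute when the disparate reputation between any two of its classes, i.e. the difference of the average reputations of the users in the two classes, is zero. *)

theory Defs
  imports Complex_Main
begin

definition avg :: "'u set \<Rightarrow> ('u \<Rightarrow> real) \<Rightarrow> real" where
  "avg S v = (\<Sum>u\<in>S. v u) / real (card S)"

definition std :: "'u set \<Rightarrow> ('u \<Rightarrow> real) \<Rightarrow> real" where
  "std S v = sqrt ((\<Sum>u\<in>S. (v u - avg S v)\<^sup>2) / real (card S))"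


text \<open>A rating \<open>R u i\<close> of \<open>0\<close> means that user \<open>u\<close> did not rate item \<open>i\<close>.\<close>

definition raters :: "'u set \<Rightarrow> ('u \<Rightarrow> 'i \<Rightarrow> real) \<Rightarrow> 'i \<Rightarrow> 'u set" where
  "raters U R i = {u \<in> U. R u i > 0}"

definition rated_items :: "'i set \<Rightarrow> ('u \<Rightarrow> 'i \<Rightarrow> real) \<Rightarrow> 'u \<Rightarrow> 'i set" where
  "rated_items I R u = {i \<in> I. R u i > 0}"

definition rating_data :: "'u set \<Rightarrow> 'i set \<Rightarrow> ('u \<Rightarrow> 'i \<Rightarrow> real) \<Rightarrow> bool" where
  "rating_data U I R \<longleftrightarrow>
     finite U \<and> U \<noteq> {} \<and> finite I \<and> I \<noteq> {} \<and>
     (\<forall>u\<in>U. \<forall>i\<in>I. 0 \<le> R u i \<and> R u i \<le> 1) \<and>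
     (\<forall>i\<in>I. raters U R i \<noteq> {}) \<and>
     (\<forall>u\<in>U. rated_items I R u \<noteq> {})"


definition ranking :: "'u set \<Rightarrow> ('u \<Rightarrow> 'i \<Rightarrow> real) \<Rightarrow> ('u \<Rightarrow> real) \<Rightarrow> 'i \<Rightarrow> real" where
  "ranking U R c i = (\<Sum>u\<in>raters U R i. R u i * c u) / (\<Sum>u\<in>raters U R i. c u)"

primrec reputation ::
  "'u set \<Rightarrow> 'i set \<Rightarrow> ('u \<Rightarrow> 'i \<Rightarrow> real) \<Rightarrow> real \<Rightarrow> nat \<Rightarrow> 'u \<Rightarrow> real" where
  "reputation U I R l 0 = (\<lambda>u. 1)"
| "reputation U I R l (Suc t) =
     (\<lambda>u. 1 - l / real (card (rated_items I R u)) *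
        (\<Sum>i\<in>rated_items I R u. \<bar>R u i - ranking U R (reputation U I R l t) i\<bar>))"


text \<open>
  The attributes are indexed by \<open>1..k\<close>: attribute \<open>j\<close> has the set of classes \<open>A j\<close>, and
  \<open>cl j u\<close> is the class of user \<open>u\<close>. Classes of different attributes are
  different objects, so that a class determines its attribute; in particular
  \<open>A 1, \<dots>, A k\<close> are pairwise different. Classes without users are allowed.
\<close>

definition attributes ::
  "'u set \<Rightarrow> nat \<Rightarrow> (nat \<Rightarrow> 'a set) \<Rightarrow> (nat \<Rightarrow> 'u \<Rightarrow> 'a) \<Rightarrow> bool" where
  "attributes U k A cl \<longleftrightarrow>
     (\<forall>j\<in>{1..k}. finite (A j) \<and> (\<forall>u\<in>U. cl j u \<in> A j)) \<and>
     (\<forall>j\<in>{1..k}. \<forall>j'\<in>{1..k}. j \<noteq> j' \<longrightarrow> A j \<inter> A j' = {})"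

definition class_users :: "'u set \<Rightarrow> ('u \<Rightarrow> 'a) \<Rightarrow> 'a \<Rightarrow> 'u set" where
  "class_users U f a = {u \<in> U. f u = a}"


text \<open>
  The mitigation step for one attribute, with set of classes \<open>C\<close> and class function \<open>f\<close>.
\<close>

definition mitigation_well_defined ::
  "'u set \<Rightarrow> 'a set \<Rightarrow> ('u \<Rightarrow> 'a) \<Rightarrow> ('u \<Rightarrow> real) \<Rightarrow> bool" where
  "mitigation_well_defined U C f c \<longleftrightarrow>
     (\<forall>a\<in>C. class_users U f a \<noteq> {} \<longrightarrow> std (class_users U f a) c > 0)"

definition mitigate :: "'u set \<Rightarrow> ('u \<Rightarrow> 'a) \<Rightarrow> ('u \<Rightarrow> real) \<Rightarrow> 'u \<Rightarrow> real" where
  "mitigate U f c u =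
     avg U c + (c u - avg (class_users U f (f u)) c) *
       (std U c / std (class_users U f (f u)) c)"

text \<open>
  The reputations after the first \<open>m\<close> steps, for the attributes \<open>p 1, \<dots>, p m\<close> in this order.
\<close>

primrec mitigate_seq ::
  "'u set \<Rightarrow> (nat \<Rightarrow> 'u \<Rightarrow> 'a) \<Rightarrow> (nat \<Rightarrow> nat) \<Rightarrow> ('u \<Rightarrow> real) \<Rightarrow> nat \<Rightarrow> 'u \<Rightarrow> real" where
  "mitigate_seq U cl p c 0 = c"
| "mitigate_seq U cl p c (Suc m) = mitigate U (cl (p (Suc m))) (mitigate_seq U cl p c m)"

end

(* Two attributes suffice. Six users are split by the first attribute into three pairs. On a class of two
   users with distinct reputations the step returns \<mu> + \<sigma> and \<mu> - \<sigma>, so after the first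
   step the reputations are \<mu> + \<sigma>, \<mu> - \<sigma>, \<mu> + \<sigma>, ... whatever the input was.
   The second attribute splits the users into two triples, with the sign patterns + - + and - + -.
   Centering these triples moves the first pair down and the last pair up. *)

theory Submission
  imports Defs
begin

lemma avg_pair: "x \<noteq> y \<Longrightarrow> avg {x, y} c = (c x + c y) / 2"
  by (simp add: avg_def)

lemma std_pair:
  assumes "x \<noteq> y"
  shows "std {x, y} c = \<bar>c x - c y\<bar> / 2"
proof -
  have "((c x - (c x + c y) / 2)\<^sup>2 + (c y - (c x + c y) / 2)\<^sup>2) / 2 = ((c x - c y) / 2)\<^sup>2"
    by (simp add: power2_eq_square field_simps)
  with assms show ?thesis
    by (simp add: std_def avg_pair)
qed

text \<open>The mean of two numbers lies at half their gap from each of them, and half the gap is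
  also their standard deviation. Standardised within the class, the two values are therefore 1 and
  -1.\<close>

lemma mitigate_pair:
  assumes "class_users U f (f x) = {x, y}" "class_users U f (f y) = {x, y}" "c y < c x"
  shows "mitigate U f c x = avg U c + std U c"
    and "mitigate U f c y = avg U c - std U c"
proof -
  have "x \<noteq> y" using assms(3) by auto
  with assms have "c x - avg {x, y} c = std {x, y} c" "c y - avg {x, y} c = - std {x, y} c"
    "std {x, y} c > 0"
    by (simp_all add: std_pair avg_pair field_simps)
  then show "mitigate U f c x = avg U c + std U c" "mitigate U f c y = avg U c - std U c"
    using assms by (simp_all add: mitigate_def)
qed

lemma std_pos_iff:
  assumes "finite S"
  shows "std S c > 0 \<longleftrightarrow> (\<exists>u\<in>S. c u \<noteq> avg S c)"
proof -
  have "std S c > 0 \<longleftrightarrow> S \<noteq> {} \<and> (\<Sum>u\<in>S. (c u - avg S c)\<^sup>2) > 0"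
    using assms by (auto simp: std_def zero_less_divide_iff card_gt_0_iff)
  also have "\<dots> \<longleftrightarrow> (\<exists>u\<in>S. c u \<noteq> avg S c)"
    using assms by (auto simp: less_le sum_nonneg sum_nonneg_eq_0_iff)
  finally show ?thesis .
qed

lemma std_pos:
  assumes "finite S" "x \<in> S" "y \<in> S" "c x \<noteq> c y"
  shows "std S c > 0"
  using assms by (metis std_pos_iff)

definition users :: "nat set" where
  "users = {0, 1, 2, 3, 4, 5}"

definition pair_of :: "nat \<Rightarrow> nat" where
  "pair_of u = u div 2"

text \<open>The offset 3 keeps these classes apart from the classes 0, 1, 2 that
  \<open>pair_of\<close> takes on \<open>users\<close>, as \<open>attributes\<close>
  demands.\<close>

definition triple_of :: "nat \<Rightarrow> nat" where
  "triple_of u = 3 + u div 3"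

lemma users_pairs:
  "class_users users pair_of 0 = {0, 1}"
  "class_users users pair_of (Suc 0) = {2, 3}"
  "class_users users pair_of 2 = {4, 5}"
  by (auto simp: class_users_def users_def pair_of_def)

lemma users_triples:
  "class_users users triple_of 3 = {0, 1, 2}"
  "class_users users triple_of 4 = {3, 4, 5}"
  by (auto simp: class_users_def users_def triple_of_def)

lemma mitigate_pairs:
  assumes "c 1 < c 0" "c 3 < c 2" "c 5 < c 4" "u \<in> users"
  shows "mitigate users pair_of c u = avg users c + (if even u then std users c else - std users c)"
proof -
  have "class_users users pair_of (pair_of 0) = {0, 1}" "class_users users pair_of (pair_of 1) = {0, 1}"
    "class_users users pair_of (pair_of 2) = {2, 3}" "class_users users pair_of (pair_of 3) = {2, 3}"
    "class_users users pair_of (pair_of 4) = {4, 5}" "class_users users pair_of (pair_of 5) = {4, 5}"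
    by (simp_all add: pair_of_def users_pairs)
  note steps = mitigate_pair[where c = c, OF this(1,2) assms(1)]
    mitigate_pair[where c = c, OF this(3,4) assms(2)] mitigate_pair[where c = c, OF this(5,6) assms(3)]
  from \<open>u \<in> users\<close> consider "u = 0" | "u = 1" | "u = 2" | "u = 3" | "u = 4" | "u = 5"
    by (auto simp: users_def)
  then show ?thesis
    using steps by cases auto
qed

text \<open>Each of the pairs {0, 1} and {4, 5} lies inside one triple. Deviations within a triple
  sum to zero, so those of the pair sum to minus the deviation of the remaining user: user 2 is
  above the mean of its triple, user 3 below.\<close>

lemma mitigate_triples_not_unbiased:
  fixes m s :: real
  assumes "s > 0" and d: "\<And>u. u \<in> users \<Longrightarrow> d u = m + (if even u then s else - s)"
  shows "avg {0, 1} (mitigate users triple_of d) < avg {4, 5} (mitigate users triple_of d)"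
proof -
  have vals: "d 0 = m + s" "d (Suc 0) = m - s" "d 2 = m + s" "d 3 = m - s" "d 4 = m + s" "d 5 = m - s"
    using d by (simp_all add: users_def)
  have avg: "avg users d = m"
    by (simp add: avg_def users_def vals)
  have std: "std users d = s"
    unfolding std_def avg using \<open>s > 0\<close> by (simp add: users_def vals)
  have avgs: "avg {0, 1, 2} d = m + s / 3" "avg {3, 4, 5} d = m - s / 3"
    by (simp_all add: avg_def vals)
  \<comment> \<open>Only the signs of the two rescaling factors matter, so their values are never
    computed.\<close>
  define q where "q = std users d / std {0, 1, 2} d"
  define q' where "q' = std users d / std {3, 4, 5} d"
  have "std {0, 1, 2} d > 0" "std {3, 4, 5} d > 0"
    using \<open>s > 0\<close> std_pos[of "{0, 1, 2}" 0 1 d] std_pos[of "{3, 4, 5}" 3 4 d]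
    by (simp_all add: vals)
  then have "q > 0" "q' > 0"
    using \<open>s > 0\<close> by (simp_all add: q_def q'_def std)
  have "mitigate users triple_of d 0 = m + 2 / 3 * s * q"
    "mitigate users triple_of d 1 = m - 4 / 3 * s * q"
    "mitigate users triple_of d 4 = m + 4 / 3 * s * q'"
    "mitigate users triple_of d 5 = m - 2 / 3 * s * q'"
    unfolding q_def q'_def
    by (simp_all add: mitigate_def triple_of_def users_triples avg
        avgs[unfolded One_nat_def] vals field_simps)
  then have "avg {0, 1} (mitigate users triple_of d) = m - s * q / 3"
    "avg {4, 5} (mitigate users triple_of d) = m + s * q' / 3"
    by (simp_all add: avg_pair)
  moreover have "s * q > 0" "s * q' > 0"
    using \<open>s > 0\<close> \<open>q > 0\<close> \<open>q' > 0\<close> by simp_all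
  ultimately show ?thesis
    by simp
qed

text \<open>The ratings of the single item average to \<open>1/2\<close>, the rating given by the users \<open>0\<close>, \<open>2\<close>, \<open>4\<close>.\<close>

definition ratings :: "nat \<Rightarrow> nat \<Rightarrow> real" where
  "ratings u i = (if even u then 1/2 else if u = 1 then 1 else 1/4)"

lemma rating_data_ratings: "rating_data users {0} ratings"
  by (auto simp: rating_data_def raters_def rated_items_def users_def ratings_def)

text \<open>With one item and equal initial reputations the ranking is the plain mean 1/2. Even
  users thus keep reputation 1 and odd users fall below it, which separates the two members of every
  pair.\<close>

lemma reputation_ratings:
  "reputation users {0} ratings (1/2) 1 u = 1 - \<bar>ratings u 0 - 1/2\<bar> / 2"
proof -
  have "raters users ratings 0 = users" "rated_items {0} ratings u = {0}"
    by (auto simp: raters_def rated_items_def ratings_def)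
  moreover from this have "ranking users ratings (\<lambda>u. 1) 0 = 1/2"
    by (simp add: ranking_def) (simp add: users_def ratings_def)
  ultimately show ?thesis
    by simp
qed

theorem proposition1:
  "\<exists>k\<ge>2. \<forall>p. bij_betw p {1..k} {1..k} \<longrightarrow>
     (\<exists>(U :: nat set) (I :: nat set) (R :: nat \<Rightarrow> nat \<Rightarrow> real)
        (A :: nat \<Rightarrow> nat set) (cl :: nat \<Rightarrow> nat \<Rightarrow> nat) (l :: real) (N :: nat).
        rating_data U I R \<and> attributes U k A cl \<and> 0 < l \<and> l < 1 \<and> 1 \<le> N \<and>
        (\<forall>m<k. mitigation_well_defined U (A (p (Suc m))) (cl (p (Suc m)))
                 (mitigate_seq U cl p (reputation U I R l N) m)) \<and>
        (\<exists>j\<in>{1..k}. \<exists>a\<in>A j. \<exists>a'\<in>A j.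
           class_users U (cl j) a \<noteq> {} \<and> class_users U (cl j) a' \<noteq> {} \<and>
           avg (class_users U (cl j) a) (mitigate_seq U cl p (reputation U I R l N) k)
             \<noteq> avg (class_users U (cl j) a') (mitigate_seq U cl p (reputation U I R l N) k)))"
proof (intro exI[of _ "2 :: nat"] conjI allI impI)
  fix p :: "nat \<Rightarrow> nat"
  assume "bij_betw p {1..2} {1..2}"
  moreover have "{1..2} = {1, 2 :: nat}"
    by auto
  ultimately have p: "p 1 \<noteq> p 2" "{1..2} = {p 1, p 2}"
    by (simp_all add: bij_betw_def)
  \<comment> \<open>The attributes may depend on the ordering: whichever comes first is made the
    pairs, so one computation settles both orderings.\<close>
  define A where "A = (\<lambda>j. if j = p 1 then {0, 1, 2 :: nat} else {3, 4})"
  define cl where "cl = (\<lambda>j. if j = p 1 then pair_of else triple_of)"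
  define c where "c = reputation users {0} ratings (1/2) 1"
  define d where "d = mitigate users pair_of c"
  have at_p: "A (p 1) = {0, 1, 2}" "A (p 2) = {3, 4}" "cl (p 1) = pair_of" "cl (p 2) = triple_of"
    using p(1) by (simp_all add: A_def cl_def)
  have c_less: "c 1 < c 0" "c 3 < c 2" "c 5 < c 4"
    unfolding c_def reputation_ratings by (simp_all add: ratings_def)
  have "std users c > 0"
    using c_less by (intro std_pos[of _ 0 1]) (auto simp: users_def)
  note d = mitigate_pairs[OF c_less, folded d_def]
  have seq: "mitigate_seq users cl p c 0 = c" "mitigate_seq users cl p c 1 = d"
    "mitigate_seq users cl p c 2 = mitigate users triple_of d"
    using at_p by (simp_all add: d_def numeral_2_eq_2)
  have "attributes users 2 A cl"
    unfolding attributes_def p(2) using p(1)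
    by (auto simp: at_p[unfolded One_nat_def] users_def pair_of_def triple_of_def)
  moreover have "mitigation_well_defined users (A (p (Suc m))) (cl (p (Suc m)))
      (mitigate_seq users cl p c m)" if "m < 2" for m
  proof -
    have pairs: "mitigation_well_defined users {0, 1, 2} pair_of c"
      unfolding mitigation_well_defined_def using c_less
        std_pos[of "{0, 1}" 0 1 c] std_pos[of "{2, 3}" 2 3 c] std_pos[of "{4, 5}" 4 5 c]
      by (simp add: users_pairs)
    have triples: "mitigation_well_defined users {3, 4} triple_of d"
      unfolding mitigation_well_defined_def using \<open>std users c > 0\<close>
        std_pos[of "{0, 1, 2}" 0 1 d] std_pos[of "{3, 4, 5}" 3 4 d]
      \<comment> \<open>\<open>users_triples\<close> matches the folded constant
        \<open>users\<close>; it is unfolded only afterwards, for the membership premise of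
        \<open>d\<close>.\<close>
      by (simp add: users_triples) (simp add: users_def d)
    from \<open>m < 2\<close> consider "m = 0" | "m = 1"
      by linarith
    then show ?thesis
      \<comment> \<open>The indices arise as \<open>Suc 0\<close> and \<open>Suc 1\<close>, whereas
        \<open>seq\<close> and \<open>at_p\<close> are stated with 1 and 2.\<close>
      by cases (simp_all only: pairs triples seq at_p Suc_1 flip: One_nat_def)
  qed
  moreover have "\<exists>j\<in>{1..2}. \<exists>a\<in>A j. \<exists>a'\<in>A j.
      class_users users (cl j) a \<noteq> {} \<and> class_users users (cl j) a' \<noteq> {} \<and>
      avg (class_users users (cl j) a) (mitigate_seq users cl p c 2)
        \<noteq> avg (class_users users (cl j) a') (mitigate_seq users cl p c 2)"
  proof (intro bexI conjI)
    \<comment> \<open>The bias shows in the attribute treated first, whose balance the second step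
      destroys. Classes 0 and 2 are the outer pairs; the middle pair straddles both triples.\<close>
    show "avg (class_users users (cl (p 1)) 0) (mitigate_seq users cl p c 2)
        \<noteq> avg (class_users users (cl (p 1)) 2) (mitigate_seq users cl p c 2)"
      unfolding seq at_p users_pairs
      using mitigate_triples_not_unbiased[OF \<open>std users c > 0\<close> d] by simp
  qed (use p(2) in \<open>auto simp: at_p[unfolded One_nat_def] users_pairs\<close>)
  ultimately show "\<exists>(U :: nat set) (I :: nat set) (R :: nat \<Rightarrow> nat \<Rightarrow> real)
        (A :: nat \<Rightarrow> nat set) (cl :: nat \<Rightarrow> nat \<Rightarrow> nat) (l :: real) (N :: nat).
        rating_data U I R \<and> attributes U 2 A cl \<and> 0 < l \<and> l < 1 \<and> 1 \<le> N \<and>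
        (\<forall>m<2. mitigation_well_defined U (A (p (Suc m))) (cl (p (Suc m)))
                 (mitigate_seq U cl p (reputation U I R l N) m)) \<and>
        (\<exists>j\<in>{1..2}. \<exists>a\<in>A j. \<exists>a'\<in>A j.
           class_users U (cl j) a \<noteq> {} \<and> class_users U (cl j) a' \<noteq> {} \<and>
           avg (class_users U (cl j) a) (mitigate_seq U cl p (reputation U I R l N) 2)
             \<noteq> avg (class_users U (cl j) a') (mitigate_seq U cl p (reputation U I R l N) 2))"
    unfolding c_def
    by (intro exI[of _ users] exI[of _ "{0}"] exI[of _ ratings] exI[of _ A] exI[of _ cl]
        exI[of _ "1/2"] exI[of _ 1]) (simp add: rating_data_ratings)
qed simp

end
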